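(* Let $(R,r,d)$ be positive real numbers with $R>r$ and $d^2=(R-r)^2-4Rr$, and put $a=1/r$, $A=-1/R$. The invariant complex moments of the poristic Steiner $4$-chains whose parent circles have the gauge $(R,r,d)$ satisfy $$J_{1,1}^2=\frac{4(A^2+6Aa+a^2)}{A^2},$$ $$J_{2,1}^2=\frac{(3a+5A)^2(A^2+6Aa+a^2)}{4A^2},$$ $$J_{3,1}^2=\frac{(5a+3A)^2(a+3A)^2(A^2+6Aa+a^2)}{16A^2},$$ $$J_{2,2}^2=\frac{9(A^2+6Aa+a^2)^2}{4A^4}.$$
   Context: A pair of parent circles of order four with the gauge $(R,r,d)$ consists of a circle $\Gamma$ of radius $R$ and a circle $\gamma$ of radius $r<R$ contained in the open disk bounded by $\Gamma$, with distance $d$ between their centers, where $d^2=(R-r)^2-4Rr$. A Steiner $4$-chain with these parent circles is a sequence of circles $\delta_1,\dots,\delta_4$, going once around $\gamma$, such that circles with cyclically adjacent indices are externally tangent and each $\delta_i$ is externally tangent to $\gamma$ and internally tangent to $\Gamma$; under the relation $d^2=(R-r)^2-4Rr$ there is a one-parameter (poristic) family of such chains. Canonical coordinate system: the origin is the center of $\Gamma$ and the $Ox$-axis is the line through the centers of $\Gamma$ and $\gamma$, oriented so that the center of $\gamma$ is the point $(d,0)$; the plane is identified with $\mathbb{C}$ by these coordinates. Complex moments: if $\delta_i$ has curvature (reciprocal of radius) $b_i>0$ and center $z_i\in\mathbb{C}$ in canonical coordinates, then $J_{k,m}=\sum_{i=1}^4 b_i^k z_i^m$. For $0\le m\le k\le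 3$ these do not depend on the choice of the chain with the given parent circles (invariant complex moments). *)

theory Defs
  imports "HOL-Complex_Analysis.Complex_Analysis"
begin

datatype circle = Circle (center: complex) (radius: real)

definition curvature :: "circle \<Rightarrow> real" where
  "curvature c = 1 / radius c"

definition externally_tangent :: "circle \<Rightarrow> circle \<Rightarrow> bool" where
  "externally_tangent c c' \<longleftrightarrow> dist (center c) (center c') = radius c + radius c'"

definition internally_tangent :: "circle \<Rightarrow> circle \<Rightarrow> bool" where
  "internally_tangent c C \<longleftrightarrow>
     radius c < radius C \<and> dist (center c) (center C) = radius C - radius c"

text \<open>
  A chain is indexed by \<open>1, \<dots>, 4\<close>; the cyclic successor of \<open>i\<close> is \<open>i mod 4 + 1\<close>.
  That it goes once around the inner circle, in either orientation, is expressed by the closed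
  polygon through the centers of the chain having winding number \<open>1\<close> or \<open>-1\<close> about the center of
  the inner circle (the tangency conditions keep the polygon away from that point).
  The other conditions alone would admit sequences that turn back, such as
  \<open>c, c', c, c'\<close> with \<open>c\<close> and \<open>c'\<close> tangent.
\<close>

definition center_polygon :: "(nat \<Rightarrow> circle) \<Rightarrow> real \<Rightarrow> complex" where
  "center_polygon \<delta> =
     linepath (center (\<delta> 1)) (center (\<delta> 2)) +++ linepath (center (\<delta> 2)) (center (\<delta> 3)) +++
     linepath (center (\<delta> 3)) (center (\<delta> 4)) +++ linepath (center (\<delta> 4)) (center (\<delta> 1))"

definition steiner_4_chain :: "circle \<Rightarrow> circle \<Rightarrow> (nat \<Rightarrow> circle) \<Rightarrow> bool" where
  "steiner_4_chain \<Gamma> \<gamma> \<delta> \<longleftrightarrow>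
     (\<forall>i\<in>{1..4}. radius (\<delta> i) > 0
        \<and> externally_tangent (\<delta> i) (\<delta> (i mod 4 + 1))
        \<and> externally_tangent (\<delta> i) \<gamma>
        \<and> internally_tangent (\<delta> i) \<Gamma>)
     \<and> winding_number (center_polygon \<delta>) (center \<gamma>) \<in> {1, -1}"

definition complex_moment :: "(nat \<Rightarrow> circle) \<Rightarrow> nat \<Rightarrow> nat \<Rightarrow> complex" where
  "complex_moment \<delta> k m = (\<Sum>i=1..4. complex_of_real (curvature (\<delta> i)) ^ k * center (\<delta> i) ^ m)"

end

theory Submission
  imports Defs
begin

text \<open>
  In Lorentzian (augmented curvature-center) coordinates the circles tangent to both parent circles
  form a conic \<open>2 u\<^sup>2 + v\<^sup>2 = 2\<close>, where \<open>v\<close> is curvature times ordinate and both the curvature and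
  its product with the abscissa are affine in \<open>u\<close>; for a gauge of order four, tangency of two such
  circles is the orthogonality \<open>2 u u' + v v' = 0\<close>. Hence circles at distance two in a chain are
  equal or antipodal on the conic. If some are equal, the polygon through the centers retraces
  itself and has winding number 0. So the chain consists of two antipodal, mutually orthogonal pairs,
  whose first, second and third power sums in \<open>(u, v)\<close> do not depend on the position of the pairs.
\<close>

section \<open>Conic coordinates of circles tangent to both parent circles\<close>

text \<open>Curvature shifted and scaled so that the two circles centered on the axis between the
  parent circles, of curvatures \<open>2 / (R - r + d)\<close> and \<open>2 / (R - r - d)\<close>,
  receive the values -1 and 1.\<close>

definition conic_coord :: "real \<Rightarrow> real \<Rightarrow> real \<Rightarrow> circle \<Rightarrow> real" where
  "conic_coord R r d c = (2 * R * r * curvature c - (R - r)) / d"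

definition curv_ordinate :: "circle \<Rightarrow> real" where
  "curv_ordinate c = curvature c * Im (center c)"

lemma curvature_eq_conic_coord:
  assumes "R > 0" "r > 0" "d > 0"
  shows "curvature c = (R - r) / (2 * R * r) + d / (2 * R * r) * conic_coord R r d c"
  using assms by (simp add: conic_coord_def field_simps)

text \<open>The linear relation is the difference of the two squared distance equations, in which
  the quadratic terms cancel; \<open>d\<^sup>2\<close> is then eliminated by the gauge.\<close>

lemma tangent_to_parents:
  assumes "d > 0"
    and d: "d\<^sup>2 = (R - r)\<^sup>2 - 4 * R * r"
    and "internally_tangent c (Circle 0 R)"
    and "externally_tangent c (Circle (complex_of_real d) r)"
    and "r > 0" "radius c > 0"
  shows "(Re (center c))\<^sup>2 + (Im (center c))\<^sup>2 = (R - radius c)\<^sup>2"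
    and "d * Re (center c) = R\<^sup>2 - 3 * R * r - (R + r) * radius c"
proof -
  have "cmod (center c) = R - radius c"
    using assms by (simp add: internally_tangent_def)
  then show 1: "(Re (center c))\<^sup>2 + (Im (center c))\<^sup>2 = (R - radius c)\<^sup>2"
    using cmod_power2[of "center c"] by simp
  have "cmod (center c - of_real d) = radius c + r"
    using assms by (simp add: externally_tangent_def dist_norm)
  then have "(Re (center c) - d)\<^sup>2 + (Im (center c))\<^sup>2 = (radius c + r)\<^sup>2"
    using cmod_power2[of "center c - of_real d"] by simp
  with 1 d show "d * Re (center c) = R\<^sup>2 - 3 * R * r - (R + r) * radius c"
    by (simp add: power2_eq_square algebra_simps)
qed

lemma curvature_times_center:
  assumes "R > 0" "r > 0" "d > 0"
    and d: "d\<^sup>2 = (R - r)\<^sup>2 - 4 * R * r"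
    and "internally_tangent c (Circle 0 R)"
    and "externally_tangent c (Circle (complex_of_real d) r)"
    and "radius c > 0"
  shows "curvature c * Re (center c) = d / (2 * r) + (R - 3 * r) / (2 * r) * conic_coord R r d c"
    and "complex_of_real (curvature c) * center c =
      Complex (d / (2 * r) + (R - 3 * r) / (2 * r) * conic_coord R r d c) (curv_ordinate c)"
proof -
  let ?b = "curvature c" and ?x = "Re (center c)"
  have b: "?b * radius c = 1" using assms by (simp add: curvature_def)
  have "d * (?b * ?x) = (R\<^sup>2 - 3 * R * r) * ?b - (R + r)"
    using tangent_to_parents(2)[of d R r c] assms b by algebra
  moreover have "d * conic_coord R r d c = 2 * R * r * ?b - (R - r)"
    using assms by (simp add: conic_coord_def)
  \<comment> \<open>After substituting for the curvature, the constant term is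
    \<open>(R - 3 * r) * (R - r) - 2 * r * (R + r)\<close>, which the gauge identifies with
    \<open>d\<^sup>2\<close>; hence a factor \<open>d\<close> can be cancelled.\<close>
  ultimately have "2 * r * d * (?b * ?x) = d * (d + (R - 3 * r) * conic_coord R r d c)"
    using d by algebra
  then have "2 * r * (?b * ?x) = d + (R - 3 * r) * conic_coord R r d c"
    using \<open>d > 0\<close> by simp
  then show *: "?b * ?x = d / (2 * r) + (R - 3 * r) / (2 * r) * conic_coord R r d c"
    using \<open>r > 0\<close> by (simp add: field_simps)
  then show "complex_of_real ?b * center c =
      Complex (d / (2 * r) + (R - 3 * r) / (2 * r) * conic_coord R r d c) (curv_ordinate c)"
    by (simp add: complex_eq_iff curv_ordinate_def)
qed

lemma conic_equation:
  assumes "R > 0" "r > 0" "d > 0"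
    and d: "d\<^sup>2 = (R - r)\<^sup>2 - 4 * R * r"
    and "internally_tangent c (Circle 0 R)"
    and "externally_tangent c (Circle (complex_of_real d) r)"
    and "radius c > 0"
  shows "2 * (conic_coord R r d c)\<^sup>2 + (curv_ordinate c)\<^sup>2 = 2"
proof -
  let ?b = "curvature c" and ?x = "Re (center c)" and ?u = "conic_coord R r d c"
  have b: "?b * radius c = 1" using assms by (simp add: curvature_def)
  have e: "(?b * ?x)\<^sup>2 + (curv_ordinate c)\<^sup>2 = (R * ?b - 1)\<^sup>2"
    using tangent_to_parents(1)[of d R r c] assms b unfolding curv_ordinate_def by algebra
  have h: "2 * r * (?b * ?x) = d + (R - 3 * r) * ?u"
    using curvature_times_center(1)[of R r d c] assms by (simp add: field_simps)
  have g: "2 * r * (R * ?b - 1) = R - 3 * r + d * ?u"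
    using assms by (simp add: conic_coord_def field_simps)
  \<comment> \<open>By \<open>h\<close> and \<open>g\<close>, \<open>e\<close> becomes a difference
    of squares equal to \<open>((R - 3 * r)\<^sup>2 - d\<^sup>2) * (1 - u\<^sup>2)\<close>, with
    \<open>u\<close> the conic coordinate, and the gauge gives
    \<open>(R - 3 * r)\<^sup>2 - d\<^sup>2 = 8 * r\<^sup>2\<close>.\<close>
  have "4 * r\<^sup>2 * (2 * ?u\<^sup>2 + (curv_ordinate c)\<^sup>2) = 4 * r\<^sup>2 * 2"
    using e h g d by algebra
  then show ?thesis using \<open>r > 0\<close> by simp
qed

text \<open>This is the polarized form of \<open>conic_equation\<close>. Tangency contributes the
  \<open>- 2\<close> in \<open>e\<close>; scaled by \<open>4 * r\<^sup>2\<close> it cancels exactly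
  the constant \<open>(R - 3 * r)\<^sup>2 - d\<^sup>2 = 8 * r\<^sup>2\<close>, so the relation
  becomes homogeneous for a gauge of order four.\<close>

lemma tangency_orthogonal:
  assumes "R > 0" "r > 0" "d > 0"
    and d: "d\<^sup>2 = (R - r)\<^sup>2 - 4 * R * r"
    and c: "internally_tangent c (Circle 0 R)"
      "externally_tangent c (Circle (complex_of_real d) r)" "radius c > 0"
    and c': "internally_tangent c' (Circle 0 R)"
      "externally_tangent c' (Circle (complex_of_real d) r)" "radius c' > 0"
    and "externally_tangent c c'"
  shows "2 * conic_coord R r d c * conic_coord R r d c' + curv_ordinate c * curv_ordinate c' = 0"
proof -
  let ?b = "curvature c" and ?x = "Re (center c)" and ?u = "conic_coord R r d c"
  let ?b' = "curvature c'" and ?x' = "Re (center c')" and ?u' = "conic_coord R r d c'"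
  have b: "?b * radius c = 1" "?b' * radius c' = 1"
    using assms by (simp_all add: curvature_def)
  have "cmod (center c - center c') = radius c + radius c'"
    using assms by (simp add: externally_tangent_def dist_norm)
  then have "(?x - ?x')\<^sup>2 + (Im (center c) - Im (center c'))\<^sup>2 = (radius c + radius c')\<^sup>2"
    using cmod_power2[of "center c - center c'"] by simp
  with tangent_to_parents(1)[of d R r c] tangent_to_parents(1)[of d R r c'] assms
  have "?x * ?x' + Im (center c) * Im (center c') =
      R\<^sup>2 - R * (radius c + radius c') - radius c * radius c'"
    by (simp add: power2_eq_square algebra_simps)
  then have e: "(?b * ?x) * (?b' * ?x') + curv_ordinate c * curv_ordinate c' =
      (R * ?b - 1) * (R * ?b' - 1) - 2"
    using b unfolding curv_ordinate_def by algebra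
  have h: "2 * r * (?b * ?x) = d + (R - 3 * r) * ?u" "2 * r * (?b' * ?x') = d + (R - 3 * r) * ?u'"
    using curvature_times_center(1)[of R r d c] curvature_times_center(1)[of R r d c'] assms
    by (simp_all add: field_simps)
  have g: "2 * r * (R * ?b - 1) = R - 3 * r + d * ?u" "2 * r * (R * ?b' - 1) = R - 3 * r + d * ?u'"
    using assms by (simp_all add: conic_coord_def field_simps)
  have "4 * r\<^sup>2 * (2 * ?u * ?u' + curv_ordinate c * curv_ordinate c') = 0"
    using e h g d by algebra
  then show ?thesis using \<open>r > 0\<close> by simp
qed

lemma center_eq_if_conic_coords_eq:
  assumes "R > 0" "r > 0" "d > 0"
    and d: "d\<^sup>2 = (R - r)\<^sup>2 - 4 * R * r"
    and c: "internally_tangent c (Circle 0 R)"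
      "externally_tangent c (Circle (complex_of_real d) r)" "radius c > 0"
    and c': "internally_tangent c' (Circle 0 R)"
      "externally_tangent c' (Circle (complex_of_real d) r)" "radius c' > 0"
    and eq: "conic_coord R r d c = conic_coord R r d c'" "curv_ordinate c = curv_ordinate c'"
  shows "center c = center c'"
proof -
  have "curvature c = curvature c'"
    using curvature_eq_conic_coord[OF assms(1-3)] eq(1) by metis
  moreover have "complex_of_real (curvature c) * center c =
      complex_of_real (curvature c') * center c'"
    using curvature_times_center(2)[OF assms(1-4) c] curvature_times_center(2)[OF assms(1-4) c'] eq
    by simp
  moreover have "curvature c \<noteq> 0" using c by (simp add: curvature_def)
  ultimately show ?thesis by simp
qed

section \<open>Antipodal pairs and the exclusion of retraced polygons\<close>

text \<open>In the plane, vectors orthogonal to the same nonzero vector are parallel, and a line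
  through the origin meets the conic in two opposite points.\<close>

lemma orthogonal_to_common_eq_or_antipodal:
  fixes u v u' v' p q :: real
  assumes "2 * u\<^sup>2 + v\<^sup>2 = 2" "2 * u'\<^sup>2 + v'\<^sup>2 = 2" "2 * p\<^sup>2 + q\<^sup>2 = 2"
    and "2 * u * p + v * q = 0" "2 * u' * p + v' * q = 0"
  shows "u' = u \<and> v' = v \<or> u' = - u \<and> v' = - v"
proof -
  have "(u * v' - u' * v) * p = 0" using assms(4,5) by algebra
  moreover have "(u * v' - u' * v) * q = 0" using assms(4,5) by algebra
  ultimately have *: "u * v' = u' * v" using assms(3) by auto
  have "(u' - u) * (u' + u) = 0" using * assms(1,2) by algebra
  moreover have "(v' - v) * (v' + v) = 0" using * assms(1,2) by algebra
  \<comment> \<open>The mixed products tie the sign chosen for the first coordinate to that of the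
    second.\<close>
  moreover have "(u' - u) * (v' + v) = 0" using * assms(1,2) by algebra
  moreover have "(u' + u) * (v' - v) = 0" using * assms(1,2) by algebra
  ultimately show ?thesis by auto
qed

text \<open>On the segment the distances would add up, giving the sum of the two radii plus twice
  the radius of the inner circle. This keeps the winding numbers of the edges well behaved.\<close>

lemma not_in_segment_tangent_centers:
  assumes "externally_tangent c \<gamma>" "externally_tangent c' \<gamma>" "externally_tangent c c'"
    and "radius \<gamma> > 0"
  shows "center \<gamma> \<notin> closed_segment (center c) (center c')"
proof
  assume "center \<gamma> \<in> closed_segment (center c) (center c')"
  then have "dist (center c) (center c') = dist (center c) (center \<gamma>) + dist (center \<gamma>) (center c')"
    by (simp add: between[symmetric] between_mem_segment)
  with assms show False
    by (simp add: externally_tangent_def dist_commute)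
qed

text \<open>Every edge is cancelled by its reverse. The two forms are the polygons of a chain whose
  third center equals the first, and whose fourth equals the second.\<close>

lemma winding_number_retraced_quadrilateral:
  assumes "z \<notin> closed_segment p q"
  shows "z \<notin> closed_segment p s \<Longrightarrow>
      winding_number (linepath p q +++ linepath q p +++ linepath p s +++ linepath s p) z = 0"
    and "z \<notin> closed_segment q s \<Longrightarrow>
      winding_number (linepath p q +++ linepath q s +++ linepath s q +++ linepath q p) z = 0"
proof -
  have rev: "winding_number (linepath y x) z = - winding_number (linepath x y) z"
    if "z \<notin> closed_segment x y" for x y
    using winding_number_reversepath[of "linepath x y" z] that by simp
  show "winding_number (linepath p q +++ linepath q p +++ linepath p s +++ linepath s p) z = 0"
    if "z \<notin> closed_segment p s"
    using that assms rev[of p q] rev[of p s]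
    by (simp add: winding_number_join path_image_join closed_segment_commute)
  show "winding_number (linepath p q +++ linepath q s +++ linepath s q +++ linepath q p) z = 0"
    if "z \<notin> closed_segment q s"
    using that assms rev[of p q] rev[of q s]
    by (simp add: winding_number_join path_image_join closed_segment_commute)
qed

section \<open>Power sums and moments\<close>

text \<open>The rows \<open>(u, v / sqrt 2)\<close> and \<open>(u', v' / sqrt 2)\<close> are
  orthonormal, so they form an orthogonal matrix, whose columns are orthonormal too.\<close>

lemma antipodal_orthogonal_power_sums:
  fixes u v u' v' :: real
  assumes "2 * u\<^sup>2 + v\<^sup>2 = 2" "2 * u'\<^sup>2 + v'\<^sup>2 = 2" "2 * u * u' + v * v' = 0"
  shows "u\<^sup>2 + u'\<^sup>2 = 1" "v\<^sup>2 + v'\<^sup>2 = 2" "u * v + u' * v' = 0"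
proof -
  have "(2 * u * u')\<^sup>2 = (v * v')\<^sup>2" using assms(3) by algebra
  then show 1: "u\<^sup>2 + u'\<^sup>2 = 1" using assms(1,2) by algebra
  then show "v\<^sup>2 + v'\<^sup>2 = 2" using assms(1,2) by algebra
  have "v\<^sup>2 = 2 * u'\<^sup>2" "v'\<^sup>2 = 2 * u\<^sup>2" "v * v' = - 2 * u * u'" using assms 1 by simp_all
  \<comment> \<open>The relations fix \<open>v\<close> and \<open>v'\<close> only up to sign, hence
    the passage to the square.\<close>
  then have "(u * v + u' * v')\<^sup>2 = 0" by algebra
  then show "u * v + u' * v' = 0" by simp
qed

lemma sum_1_4: "(\<Sum>i=1..4. f i) = f 1 + f 2 + f 3 + f (4::nat)"
  by (simp add: eval_nat_numeral)

text \<open>With \<open>w = b * z\<close>, each summand is \<open>b ^ (k - m) * w ^ m\<close>, a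
  polynomial of degree at most 3 in \<open>u\<close> and \<open>v\<close>. Odd power sums vanish by
  antipodality, and the quadratic ones are twice those in \<open>ps\<close>.\<close>

lemma moments_antipodal_pairs:
  fixes b u v :: "nat \<Rightarrow> real" and z :: "nat \<Rightarrow> complex"
  assumes b: "\<And>i. i \<in> {1..4} \<Longrightarrow> b i = s + t * u i"
    and z: "\<And>i. i \<in> {1..4} \<Longrightarrow> of_real (b i) * z i = Complex (p + q * u i) (v i)"
    and anti: "u 3 = - u 1" "v 3 = - v 1" "u 4 = - u 2" "v 4 = - v 2"
    and ps: "(u 1)\<^sup>2 + (u 2)\<^sup>2 = 1" "(v 1)\<^sup>2 + (v 2)\<^sup>2 = 2" "u 1 * v 1 + u 2 * v 2 = 0"
  shows "(\<Sum>i=1..4. of_real (b i) ^ 1 * z i ^ 1) = of_real (4 * p)"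
    and "(\<Sum>i=1..4. of_real (b i) ^ 2 * z i ^ 1) = of_real (4 * s * p + 2 * t * q)"
    and "(\<Sum>i=1..4. of_real (b i) ^ 3 * z i ^ 1) =
           of_real (4 * s\<^sup>2 * p + 2 * t\<^sup>2 * p + 4 * s * t * q)"
    and "(\<Sum>i=1..4. of_real (b i) ^ 2 * z i ^ 2) = of_real (4 * p\<^sup>2 + 2 * q\<^sup>2 - 4)"
proof -
  have b': "b 1 = s + t * u 1" "b 2 = s + t * u 2" "b 3 = s - t * u 1" "b 4 = s - t * u 2"
    using b[of 1] b[of 2] b[of 3] b[of 4] anti by simp_all
  define w where "w i = Complex (p + q * u i) (v i)" for i
  have w: "Re (w 1) = p + q * u 1" "Re (w 2) = p + q * u 2"
      "Re (w 3) = p - q * u 1" "Re (w 4) = p - q * u 2"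
      "Im (w 1) = v 1" "Im (w 2) = v 2" "Im (w 3) = - v 1" "Im (w 4) = - v 2"
    by (simp_all add: w_def anti)
  have "(\<Sum>i=1..4. of_real (b i) ^ 1 * z i ^ 1) = (\<Sum>i=1..4. w i)"
    by (intro sum.cong) (simp_all add: z w_def)
  also have "\<dots> = of_real (4 * p)"
    unfolding sum_1_4 by (simp add: complex_eq_iff w del: One_nat_def)
  finally show "(\<Sum>i=1..4. of_real (b i) ^ 1 * z i ^ 1) = of_real (4 * p)" .
  have "(\<Sum>i=1..4. of_real (b i) ^ 2 * z i ^ 1) = (\<Sum>i=1..4. of_real (b i) * w i)"
    by (intro sum.cong) (simp_all add: z[symmetric] w_def power2_eq_square)
  also have "\<dots> = of_real (4 * s * p + 2 * t * q)"
    unfolding sum_1_4 complex_eq_iff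
    using ps by (simp add: w b' del: One_nat_def) algebra
  finally show "(\<Sum>i=1..4. of_real (b i) ^ 2 * z i ^ 1) = of_real (4 * s * p + 2 * t * q)" .
  have "(\<Sum>i=1..4. of_real (b i) ^ 3 * z i ^ 1) = (\<Sum>i=1..4. of_real ((b i)\<^sup>2) * w i)"
    by (intro sum.cong) (simp_all add: z[symmetric] w_def power2_eq_square power3_eq_cube)
  also have "\<dots> = of_real (4 * s\<^sup>2 * p + 2 * t\<^sup>2 * p + 4 * s * t * q)"
    unfolding sum_1_4 complex_eq_iff plus_complex.sel Re_complex_of_real Im_complex_of_real
      times_complex.sel w b'
    using ps by (intro conjI; algebra)
  finally show "(\<Sum>i=1..4. of_real (b i) ^ 3 * z i ^ 1) =
           of_real (4 * s\<^sup>2 * p + 2 * t\<^sup>2 * p + 4 * s * t * q)" .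
  have "(\<Sum>i=1..4. of_real (b i) ^ 2 * z i ^ 2) = (\<Sum>i=1..4. w i * w i)"
    by (intro sum.cong) (simp_all add: z[symmetric] w_def power2_eq_square)
  also have "\<dots> = of_real (4 * p\<^sup>2 + 2 * q\<^sup>2 - 4)"
    unfolding sum_1_4 complex_eq_iff plus_complex.sel Re_complex_of_real Im_complex_of_real
      times_complex.sel w
    using ps by (intro conjI; algebra)
  finally show "(\<Sum>i=1..4. of_real (b i) ^ 2 * z i ^ 2) = of_real (4 * p\<^sup>2 + 2 * q\<^sup>2 - 4)" .
qed

theorem proposition6:
  fixes R r d a A :: real and \<delta> :: "nat \<Rightarrow> circle"
  assumes "R > 0" and "r > 0" and "d > 0" and "R > r"
    and "d\<^sup>2 = (R - r)\<^sup>2 - 4 * R * r"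
    and "a = 1 / r" and "A = - 1 / R"
    and "steiner_4_chain (Circle 0 R) (Circle (complex_of_real d) r) \<delta>"
  shows "(complex_moment \<delta> 1 1)\<^sup>2
           = complex_of_real (4 * (A\<^sup>2 + 6 * A * a + a\<^sup>2) / A\<^sup>2)
       \<and> (complex_moment \<delta> 2 1)\<^sup>2
           = complex_of_real ((3 * a + 5 * A)\<^sup>2 * (A\<^sup>2 + 6 * A * a + a\<^sup>2) / (4 * A\<^sup>2))
       \<and> (complex_moment \<delta> 3 1)\<^sup>2
           = complex_of_real
               ((5 * a + 3 * A)\<^sup>2 * (a + 3 * A)\<^sup>2 * (A\<^sup>2 + 6 * A * a + a\<^sup>2) / (16 * A\<^sup>2))
       \<and> (complex_moment \<delta> 2 2)\<^sup>2
           = complex_of_real (9 * (A\<^sup>2 + 6 * A * a + a\<^sup>2)\<^sup>2 / (4 * A ^ 4))"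
proof -
  let ?\<gamma> = "Circle (complex_of_real d) r"
  define u where "u i = conic_coord R r d (\<delta> i)" for i
  define v where "v i = curv_ordinate (\<delta> i)" for i
  have rad: "radius (\<delta> i) > 0" and int: "internally_tangent (\<delta> i) (Circle 0 R)"
    and ext: "externally_tangent (\<delta> i) ?\<gamma>"
    and adj: "externally_tangent (\<delta> i) (\<delta> (i mod 4 + 1))" if "i \<in> {1..4}" for i
    using assms(8) that unfolding steiner_4_chain_def by blast+
  note parents = assms(1-3,5)
  have conic: "2 * (u i)\<^sup>2 + (v i)\<^sup>2 = 2" if "i \<in> {1..4}" for i
    unfolding u_def v_def using conic_equation[OF parents int ext rad] that by blast
  have adj': "externally_tangent (\<delta> 1) (\<delta> 2)" "externally_tangent (\<delta> 2) (\<delta> 3)"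
    "externally_tangent (\<delta> 3) (\<delta> 4)" "externally_tangent (\<delta> 4) (\<delta> 1)"
    using adj[of 1] adj[of 2] adj[of 3] adj[of 4] by (simp_all del: One_nat_def)
  have orth: "2 * u i * u j + v i * v j = 0"
    if "externally_tangent (\<delta> i) (\<delta> j)" "i \<in> {1..4}" "j \<in> {1..4}" for i j
    unfolding u_def v_def using tangency_orthogonal[OF parents int ext rad int ext rad] that by blast
  note orths = orth[OF adj'(1)] orth[OF adj'(2)] orth[OF adj'(3)] orth[OF adj'(4)]
  have seg: "complex_of_real d \<notin> closed_segment (center (\<delta> i)) (center (\<delta> j))"
    if "externally_tangent (\<delta> i) (\<delta> j)" "i \<in> {1..4}" "j \<in> {1..4}" for i j
    using not_in_segment_tangent_centers[OF ext ext that(1), OF that(2,3)] \<open>r > 0\<close> by simp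
  have wind: "winding_number (center_polygon \<delta>) (complex_of_real d) \<noteq> 0"
    using assms(8) unfolding steiner_4_chain_def by auto
  have same: "center (\<delta> i) = center (\<delta> j)"
    if "u i = u j" "v i = v j" "i \<in> {1..4}" "j \<in> {1..4}" for i j
    using center_eq_if_conic_coords_eq[OF parents int ext rad int ext rad] that
    unfolding u_def v_def by blast
  have "center (\<delta> 3) \<noteq> center (\<delta> 1)"
  proof
    assume *: "center (\<delta> 3) = center (\<delta> 1)"
    show False
      using wind winding_number_retraced_quadrilateral(1)[OF seg[OF adj'(1)]]
        seg[OF adj'(4)] unfolding center_polygon_def *
      by (simp add: closed_segment_commute)
  qed
  \<comment> \<open>Circles 1 and 3 are both orthogonal to circle 2; the equal case is ruled out
    since it would make the centers coincide.\<close>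
  then have A13: "u 3 = - u 1" "v 3 = - v 1"
    using orthogonal_to_common_eq_or_antipodal[OF conic[of 1] conic[of 3] conic[of 2]]
      orths(1,2) same[of 3 1] by (auto simp: mult_ac)
  have "center (\<delta> 4) \<noteq> center (\<delta> 2)"
  proof
    assume *: "center (\<delta> 4) = center (\<delta> 2)"
    show False
      using wind winding_number_retraced_quadrilateral(2)[OF seg[OF adj'(1)] seg[OF adj'(2)]]
      unfolding center_polygon_def * by simp
  qed
  then have A24: "u 4 = - u 2" "v 4 = - v 2"
    using orthogonal_to_common_eq_or_antipodal[OF conic[of 2] conic[of 4] conic[of 1]]
      orths(1,4) same[of 4 2] by (auto simp: mult_ac)
  have ps: "(u 1)\<^sup>2 + (u 2)\<^sup>2 = 1" "(v 1)\<^sup>2 + (v 2)\<^sup>2 = 2" "u 1 * v 1 + u 2 * v 2 = 0"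
    using antipodal_orthogonal_power_sums[OF conic[of 1] conic[of 2] orths(1)] by simp_all
  have b: "curvature (\<delta> i) = (R - r) / (2 * R * r) + d / (2 * R * r) * u i" for i
    unfolding u_def by (rule curvature_eq_conic_coord[OF assms(1-3)])
  have bz: "complex_of_real (curvature (\<delta> i)) * center (\<delta> i) =
      Complex (d / (2 * r) + (R - 3 * r) / (2 * r) * u i) (v i)" if "i \<in> {1..4}" for i
    unfolding u_def v_def using curvature_times_center(2)[OF parents int ext rad] that by blast
  have "a * r = 1" "A * R = - 1" using assms(1,2,6,7) by simp_all
  then have "(A\<^sup>2 + 6 * A * a + a\<^sup>2) * (R * r)\<^sup>2 = d\<^sup>2"
    using assms(5) by algebra
  \<comment> \<open>The common factor of the claimed values is thus a square, so the moments
    themselves can be computed as rational expressions and squared at the end.\<close>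
  then have disc: "A\<^sup>2 + 6 * A * a + a\<^sup>2 = (d / (R * r))\<^sup>2"
    using assms(1,2) by (simp add: power_divide eq_divide_eq)
  have m11: "4 * (d / (2 * r)) = 2 * d / r" by simp
  have m21: "4 * ((R - r) / (2 * R * r)) * (d / (2 * r)) +
      2 * (d / (2 * R * r)) * ((R - 3 * r) / (2 * r)) = d * (3 * a + 5 * A) / (2 * r)"
    unfolding assms(6,7) using assms(1,2) by (simp add: field_simps power2_eq_square)
  \<comment> \<open>Only after eliminating \<open>d\<^sup>2\<close> does the bracket factor; the
    factors are \<open>R * r\<close> times \<open>5 * a + 3 * A\<close> and
    \<open>a + 3 * A\<close>.\<close>
  have "2 * (R - r)\<^sup>2 + d\<^sup>2 + 2 * (R - r) * (R - 3 * r) = (5 * R - 3 * r) * (R - 3 * r)"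
    using assms(5) by algebra
  moreover have "4 * ((R - r) / (2 * R * r))\<^sup>2 * (d / (2 * r)) +
      2 * (d / (2 * R * r))\<^sup>2 * (d / (2 * r)) +
      4 * ((R - r) / (2 * R * r)) * (d / (2 * R * r)) * ((R - 3 * r) / (2 * r)) =
      d * (2 * (R - r)\<^sup>2 + d\<^sup>2 + 2 * (R - r) * (R - 3 * r)) / (4 * R\<^sup>2 * r ^ 3)"
    using assms(1,2) by (simp add: field_simps power2_eq_square power3_eq_cube)
  moreover have "d * ((5 * R - 3 * r) * (R - 3 * r)) / (4 * R\<^sup>2 * r ^ 3) =
      d * (5 * a + 3 * A) * (a + 3 * A) / (4 * r)"
    unfolding assms(6,7) using assms(1,2)
    by (simp add: field_simps power2_eq_square power3_eq_cube)
  ultimately have m31: "4 * ((R - r) / (2 * R * r))\<^sup>2 * (d / (2 * r)) +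
      2 * (d / (2 * R * r))\<^sup>2 * (d / (2 * r)) +
      4 * ((R - r) / (2 * R * r)) * (d / (2 * R * r)) * ((R - 3 * r) / (2 * r)) =
      d * (5 * a + 3 * A) * (a + 3 * A) / (4 * r)"
    by simp
  have "(R - 3 * r)\<^sup>2 = d\<^sup>2 + 8 * r\<^sup>2"
    using assms(5) by algebra
  then have m22: "4 * (d / (2 * r))\<^sup>2 + 2 * ((R - 3 * r) / (2 * r))\<^sup>2 - 4 = 3 * d\<^sup>2 / (2 * r\<^sup>2)"
    unfolding power_divide using assms(2) by (simp add: field_simps)
  have moments: "complex_moment \<delta> 1 1 = of_real (2 * d / r)"
    "complex_moment \<delta> 2 1 = of_real (d * (3 * a + 5 * A) / (2 * r))"
    "complex_moment \<delta> 3 1 = of_real (d * (5 * a + 3 * A) * (a + 3 * A) / (4 * r))"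
    "complex_moment \<delta> 2 2 = of_real (3 * d\<^sup>2 / (2 * r\<^sup>2))"
    \<comment> \<open>Read from right to left, the closed forms become the expressions of
      \<open>moments_antipodal_pairs\<close> in \<open>s\<close>, \<open>t\<close>,
      \<open>p\<close>, \<open>q\<close>, whose values are read off from \<open>b\<close> and
      \<open>bz\<close>.\<close>
    unfolding complex_moment_def m11[symmetric] m21[symmetric] m31[symmetric] m22[symmetric]
    by (rule moments_antipodal_pairs[of "\<lambda>i. curvature (\<delta> i)", OF b bz A13 A24 ps]; simp)+
  show ?thesis
    unfolding disc moments of_real_power[symmetric] of_real_eq_iff
    using assms(1,2,7) by (simp add: power_divide power_mult_distrib) (simp add: mult_ac)
qed

end
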